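(* Let $n\ge 1$, let $\varphi=(\varphi_1,\dots,\varphi_n)$ and $\psi=(\psi_1,\dots,\psi_n)$ be holomorphic self-maps of $\mathcal{H}^n$, and let $\gamma=(\gamma_1,\dots,\gamma_n)$ with $\gamma_k>0$ for all $k$. Then the following are equivalent: (1) $\displaystyle \sup_{z\in\mathcal{H}^n}\left(\prod_{k=1}^n\left(\frac{\mathrm{Im}\, z_k}{\mathrm{Im}\,\varphi_k(z)}\right)^{\gamma_k}+\prod_{k=1}^n\left(\frac{\mathrm{Im}\, z_k}{\mathrm{Im}\,\psi_k(z)}\right)^{\gamma_k}\right)\rho(z)<\infty$; (2) $C_\varphi-C_\psi:\mathcal{A}^{-\gamma}(\mathcal{H}^n)\to\mathcal{A}^{-\gamma}(\mathcal{H}^n)$ is bounded.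
   Context: $\mathcal{H}=\{z\in\mathbb{C}:\mathrm{Im}\,z>0\}$ and $\mathcal{H}^n=\{z=(z_1,\dots,z_n)\in\mathbb{C}^n:\mathrm{Im}\,z_k>0,\ k=1,\dots,n\}$. $H(\mathcal{H}^n)$ is the set of holomorphic functions on $\mathcal{H}^n$. For $\gamma\in\mathbb{R}^n$ with all $\gamma_k>0$, the Korenblum space is the Banach space $$\mathcal{A}^{-\gamma}(\mathcal{H}^n)=\Big\{f\in H(\mathcal{H}^n):\|f\|_{\mathcal{A}^{-\gamma}(\mathcal{H}^n)}=\sup_{z\in\mathcal{H}^n}|f(z)|\prod_{k=1}^n(\mathrm{Im}\,z_k)^{\gamma_k}<\infty\Big\}.$$ For a holomorphic self-map $\varphi$ of $\mathcal{H}^n$, the composition operator is $(C_\varphi f)(z)=f(\varphi(z))$ for $f\in H(\mathcal{H}^n)$. Saying that $C_\varphi-C_\psi:\mathcal{A}^{-\gamma}(\mathcal{H}^n)\to\mathcal{A}^{-\gamma}(\mathcal{H}^n)$ is bounded means that it maps $\mathcal{A}^{-\gamma}(\mathcal{H}^n)$ into itself and is a bounded linear operator there. For $u,v\in\mathcal{H}$, $d(u,v)=\left|\frac{u-v}{u-\overline{v}}\right|$ is the pseudo-hyperbolic distance. For $z,w\in\mathcal{H}^n$, $\rho(z,w)=\max_{1\le k\le n}d(z_k,w_k)$. For the given $\varphi,\psi$, $\rho(z):=\rho(\varphi(z),\psi(z))$. *)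

theory Defs
  imports "HOL-Analysis.Analysis"
begin

definition half_plane_poly :: "(complex ^ 'n) set" where
  "half_plane_poly = {z. \<forall>k. Im (z $ k) > 0}"

text \<open>Holomorphy in several variables on an open set: complex Frechet differentiability at every
  point. \<open>has_derivative\<close> only gives a real-linear \<open>D\<close>; homogeneity over the complex
  numbers makes it complex-linear.\<close>

definition holomorphic_several_on :: "(complex ^ 'n \<Rightarrow> complex) \<Rightarrow> (complex ^ 'n) set \<Rightarrow> bool" where
  "holomorphic_several_on f S \<longleftrightarrow>
     (\<forall>z\<in>S. \<exists>D. (f has_derivative D) (at z) \<and> (\<forall>c v. D (c *s v) = c * D v))"

definition holomorphic_self_map :: "(complex ^ 'n \<Rightarrow> complex ^ 'n) \<Rightarrow> bool" where
  "holomorphic_self_map \<phi> \<longleftrightarrow>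
     \<phi> \<in> half_plane_poly \<rightarrow> half_plane_poly \<and>
     (\<forall>k. holomorphic_several_on (\<lambda>z. \<phi> z $ k) half_plane_poly)"

text \<open>HOL functions are total, so an element of the Korenblum space is represented by any of its
  extensions to all of \<open>complex ^ 'n\<close>. Only the values on \<open>half_plane_poly\<close> enter the
  definitions below, and two functions represent the same element iff they agree there.\<close>

definition korenblum_weighted :: "real ^ 'n \<Rightarrow> (complex ^ 'n \<Rightarrow> complex) \<Rightarrow> complex ^ 'n \<Rightarrow> real" where
  "korenblum_weighted \<gamma> f z = cmod (f z) * (\<Prod>k\<in>UNIV. Im (z $ k) powr (\<gamma> $ k))"

definition korenblum_space :: "real ^ 'n \<Rightarrow> (complex ^ 'n \<Rightarrow> complex) set" where
  "korenblum_space \<gamma> =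
     {f. holomorphic_several_on f half_plane_poly \<and>
         bdd_above (korenblum_weighted \<gamma> f ` half_plane_poly)}"

text \<open>Meaningful only on \<open>korenblum_space\<close>, where the supremum is finite.\<close>

definition korenblum_norm :: "real ^ 'n \<Rightarrow> (complex ^ 'n \<Rightarrow> complex) \<Rightarrow> real" where
  "korenblum_norm \<gamma> f = (SUP z\<in>half_plane_poly. korenblum_weighted \<gamma> f z)"

text \<open>Linearity and the norm bound together force \<open>T\<close> to respect equality on
  \<open>half_plane_poly\<close>, so \<open>T\<close> induces an operator on the actual Korenblum space.\<close>

definition korenblum_bounded_operator ::
  "real ^ 'n \<Rightarrow> ((complex ^ 'n \<Rightarrow> complex) \<Rightarrow> complex ^ 'n \<Rightarrow> complex) \<Rightarrow> bool" where
  "korenblum_bounded_operator \<gamma> T \<longleftrightarrow>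
     T \<in> korenblum_space \<gamma> \<rightarrow> korenblum_space \<gamma> \<and>
     (\<forall>f\<in>korenblum_space \<gamma>. \<forall>g\<in>korenblum_space \<gamma>. \<forall>z\<in>half_plane_poly.
        T (\<lambda>w. f w + g w) z = T f z + T g z) \<and>
     (\<forall>c. \<forall>f\<in>korenblum_space \<gamma>. \<forall>z\<in>half_plane_poly.
        T (\<lambda>w. c * f w) z = c * T f z) \<and>
     (\<exists>C. \<forall>f\<in>korenblum_space \<gamma>. korenblum_norm \<gamma> (T f) \<le> C * korenblum_norm \<gamma> f)"

definition composition_operator ::
  "(complex ^ 'n \<Rightarrow> complex ^ 'n) \<Rightarrow> (complex ^ 'n \<Rightarrow> complex) \<Rightarrow> complex ^ 'n \<Rightarrow> complex" where
  "composition_operator \<phi> f z = f (\<phi> z)"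

definition pseudo_hyperbolic_dist :: "complex \<Rightarrow> complex \<Rightarrow> real" where
  "pseudo_hyperbolic_dist u v = cmod ((u - v) / (u - cnj v))"

definition pseudo_hyperbolic_max :: "complex ^ 'n \<Rightarrow> complex ^ 'n \<Rightarrow> real" where
  "pseudo_hyperbolic_max z w = (MAX k\<in>UNIV. pseudo_hyperbolic_dist (z $ k) (w $ k))"

end

theory Submission
  imports Defs "HOL-Complex_Analysis.Cauchy_Integral_Formula"
begin

text \<open>
  Write \<open>W(z) = \<Prod>\<^sub>k (Im z\<^sub>k)\<^bsup>\<gamma>\<^sub>k\<^esup>\<close> for the weight of the Korenblum space. Since the quotients in
  the theorem are \<open>W(z) / W(\<phi>(z))\<close> and \<open>W(z) / W(\<psi>(z))\<close>, it is enough to compare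
  \<open>|f(u) - f(v)|\<close>, for \<open>u = \<phi>(z)\<close> and \<open>v = \<psi>(z)\<close>, with \<open>\<rho>(u,v) (1/W(u) + 1/W(v))\<close>.

  The supremum condition implies boundedness because every \<open>f\<close> in the space satisfies
  \<open>|f(u) - f(v)| \<le> C \<parallel>f\<parallel> \<rho>(u,v) (1/W(u) + 1/W(v))\<close> with \<open>C\<close> depending only on \<open>\<gamma>\<close>
  (lemma \<open>korenblum_difference_bound\<close>). For \<open>\<rho>(u,v) > 1/10\<close> this is the triangle inequality.
  For \<open>\<rho> = \<rho>(u,v) \<le> 1/10\<close> all coordinates satisfy \<open>|u\<^sub>k - v\<^sub>k| \<le> (5/2) \<rho> Im u\<^sub>k\<close>, so
  the complex line \<open>\<zeta> \<mapsto> u + \<zeta> (v - u)/\<rho>\<close>, which passes through \<open>u\<close> at \<open>0\<close> and through \<open>v\<close> at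
  \<open>\<rho>\<close>, keeps every imaginary part at least \<open>Im u\<^sub>k / 2\<close> for \<open>|\<zeta>| \<le> 1/5\<close>. There \<open>|f|\<close> is at most
  \<open>2\<^bsup>\<Sum>\<gamma>\<^sub>k\<^esup> \<parallel>f\<parallel> / W(u)\<close>, and Cauchy's estimate for this function of one variable gives the
  factor \<open>\<rho>\<close>.

  Conversely, boundedness is tested on the functions
  \<open>K\<^sub>u(w) = \<Prod>\<^sub>k (-i (w\<^sub>k - cnj u\<^sub>k))\<^bsup>-\<gamma>\<^sub>k\<^esup>\<close>, which have norm at most \<open>1\<close> whereas
  \<open>|K\<^sub>u(u)|\<close> is a fixed multiple of \<open>1/W(u)\<close>, and on their products with the Blaschke factors
  \<open>B(w) = (w\<^sub>j - u\<^sub>j) / (w\<^sub>j - cnj u\<^sub>j)\<close>, which have norm at most \<open>1\<close> as well. As \<open>B\<close> vanishes at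
  \<open>u\<close> and \<open>|B(v)|\<close> is the distance \<open>d\<close> of \<open>u\<^sub>j\<close> and \<open>v\<^sub>j\<close>, the second function controls
  \<open>|K\<^sub>u(v)| d\<close> and the first controls \<open>|K\<^sub>u(u) - K\<^sub>u(v)|\<close>; together they control
  \<open>|K\<^sub>u(u)| d\<close>, that is, \<open>d / W(u)\<close>. Taking for \<open>j\<close> the coordinate of maximal distance gives one
  half of the supremum condition, and exchanging \<open>\<phi>\<close> and \<open>\<psi>\<close> gives the other.
\<close>

section \<open>Holomorphic functions of several variables\<close>

lemma holomorphic_several_on_mult:
  assumes "holomorphic_several_on f S" "holomorphic_several_on g S"
  shows "holomorphic_several_on (\<lambda>z. f z * g z) S"
  unfolding holomorphic_several_on_def
proof
  fix z assume "z \<in> S"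
  then obtain D E where D: "(f has_derivative D) (at z)" "\<And>c v. D (c *s v) = c * D v"
    and E: "(g has_derivative E) (at z)" "\<And>c v. E (c *s v) = c * E v"
    using assms unfolding holomorphic_several_on_def by metis
  have "((\<lambda>z. f z * g z) has_derivative (\<lambda>h. f z * E h + D h * g z)) (at z)"
    by (rule has_derivative_mult[OF D(1) E(1)])
  moreover have "\<forall>c v. f z * E (c *s v) + D (c *s v) * g z = c * (f z * E v + D v * g z)"
    by (simp add: D(2) E(2) algebra_simps)
  ultimately show "\<exists>D. ((\<lambda>z. f z * g z) has_derivative D) (at z) \<and> (\<forall>c v. D (c *s v) = c * D v)"
    by blast
qed

lemma holomorphic_several_on_diff:
  assumes "holomorphic_several_on f S" "holomorphic_several_on g S"
  shows "holomorphic_several_on (\<lambda>z. f z - g z) S"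
  unfolding holomorphic_several_on_def
proof
  fix z assume "z \<in> S"
  then obtain D E where D: "(f has_derivative D) (at z)" "\<And>c v. D (c *s v) = c * D v"
    and E: "(g has_derivative E) (at z)" "\<And>c v. E (c *s v) = c * E v"
    using assms unfolding holomorphic_several_on_def by metis
  have "((\<lambda>z. f z - g z) has_derivative (\<lambda>h. D h - E h)) (at z)"
    by (rule has_derivative_diff[OF D(1) E(1)])
  moreover have "\<forall>c v. D (c *s v) - E (c *s v) = c * (D v - E v)"
    by (simp add: D(2) E(2) algebra_simps)
  ultimately show "\<exists>D. ((\<lambda>z. f z - g z) has_derivative D) (at z) \<and> (\<forall>c v. D (c *s v) = c * D v)"
    by blast
qed

lemma holomorphic_several_on_prod:
  assumes "finite A" "\<And>k. k \<in> A \<Longrightarrow> holomorphic_several_on (f k) S"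
  shows "holomorphic_several_on (\<lambda>z. \<Prod>k\<in>A. f k z) S"
  using assms
proof (induction A rule: finite_induct)
  case empty
  show ?case
    unfolding holomorphic_several_on_def by (auto intro!: exI[of _ "\<lambda>h. 0"])
next
  case (insert a A)
  then show ?case
    by (simp add: holomorphic_several_on_mult)
qed

lemma holomorphic_several_on_coordinate:
  assumes "\<And>z. z \<in> S \<Longrightarrow> g field_differentiable at (z $ k)"
  shows "holomorphic_several_on (\<lambda>z. g (z $ k)) S"
  unfolding holomorphic_several_on_def
proof
  fix z assume "z \<in> S"
  then obtain d where "(g has_field_derivative d) (at (z $ k))"
    using assms unfolding field_differentiable_def by blast
  then have "(g has_derivative (*) d) (at (z $ k))"
    by (simp add: has_field_derivative_def)
  moreover have "((\<lambda>z. z $ k) has_derivative (\<lambda>h. h $ k)) (at z)"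
    by (intro bounded_linear_imp_has_derivative bounded_linear_vec_nth)
  ultimately have "((\<lambda>z. g (z $ k)) has_derivative (\<lambda>h. d * h $ k)) (at z)"
    using has_derivative_compose by blast
  then show "\<exists>D. ((\<lambda>z. g (z $ k)) has_derivative D) (at z) \<and> (\<forall>c v. D (c *s v) = c * D v)"
    by (auto intro!: exI[of _ "\<lambda>h. d * h $ k"])
qed

lemma has_derivative_vec_lambda:
  fixes f :: "'a::real_normed_vector \<Rightarrow> 'b::euclidean_space ^ 'n"
  assumes "\<And>k. ((\<lambda>x. f x $ k) has_derivative D k) (at x)"
  shows "(f has_derivative (\<lambda>h. \<chi> k. D k h)) (at x)"
proof -
  have "((\<lambda>x. f x \<bullet> i) has_derivative (\<lambda>h. (\<chi> k. D k h) \<bullet> i)) (at x)"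
    if i: "i \<in> Basis" for i :: "'b ^ 'n"
  proof -
    obtain k b where "i = axis k b"
      using i by (auto simp: Basis_vec_def)
    moreover have "((\<lambda>x. f x $ k \<bullet> b) has_derivative (\<lambda>h. D k h \<bullet> b)) (at x)"
      using has_derivative_inner_left[OF assms] .
    ultimately show ?thesis
      by (simp add: inner_axis)
  qed
  then show ?thesis
    by (subst has_derivative_componentwise_within) blast
qed

lemma holomorphic_several_on_compose:
  assumes f: "holomorphic_several_on f T"
    and \<phi>: "\<And>k. holomorphic_several_on (\<lambda>z. \<phi> z $ k) S" "\<phi> \<in> S \<rightarrow> T"
  shows "holomorphic_several_on (\<lambda>z. f (\<phi> z)) S"
  unfolding holomorphic_several_on_def
proof
  fix z assume z: "z \<in> S"
  then obtain D where D: "(f has_derivative D) (at (\<phi> z))" "\<And>c v. D (c *s v) = c * D v"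
    using f \<phi>(2) unfolding holomorphic_several_on_def by blast
  have "\<forall>k. \<exists>E. ((\<lambda>z. \<phi> z $ k) has_derivative E) (at z) \<and> (\<forall>c v. E (c *s v) = c * E v)"
    using \<phi>(1) z unfolding holomorphic_several_on_def by blast
  from choice[OF this] obtain E where E: "\<And>k. ((\<lambda>z. \<phi> z $ k) has_derivative E k) (at z)"
    "\<And>k c v. E k (c *s v) = c * E k v"
    by blast
  have "((\<lambda>z. f (\<phi> z)) has_derivative (\<lambda>h. D (\<chi> k. E k h))) (at z)"
    using has_derivative_compose[OF has_derivative_vec_lambda[OF E(1)] D(1)] .
  moreover have "(\<chi> k. E k (c *s v)) = c *s (\<chi> k. E k v)" for c v
    by (simp add: vec_eq_iff E(2))
  ultimately show "\<exists>D. ((\<lambda>z. f (\<phi> z)) has_derivative D) (at z) \<and> (\<forall>c v. D (c *s v) = c * D v)"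
    using D(2) by (auto intro!: exI[of _ "\<lambda>h. D (\<chi> k. E k h)"])
qed

text \<open>Complex homogeneity of the derivative is exactly what makes the restriction to a complex line
  holomorphic in the parameter of the line.\<close>

lemma holomorphic_several_on_line:
  assumes f: "holomorphic_several_on f S"
    and line: "\<And>\<zeta>. \<zeta> \<in> A \<Longrightarrow> u + \<zeta> *s h \<in> S"
  shows "(\<lambda>\<zeta>. f (u + \<zeta> *s h)) holomorphic_on A"
proof (rule holomorphic_onI)
  fix \<zeta> assume "\<zeta> \<in> A"
  then obtain D where D: "(f has_derivative D) (at (u + \<zeta> *s h))" "\<And>c v. D (c *s v) = c * D v"
    using f line unfolding holomorphic_several_on_def by blast
  have "linear (\<lambda>\<zeta>::complex. \<zeta> *s h)"
    by (rule linearI) (simp_all add: vec_eq_iff algebra_simps)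
  then have "((\<lambda>\<zeta>. \<zeta> *s h) has_derivative (\<lambda>\<zeta>. \<zeta> *s h)) (at \<zeta>)"
    by (intro bounded_linear_imp_has_derivative) (simp add: linear_conv_bounded_linear)
  then have "((\<lambda>\<zeta>. u + \<zeta> *s h) has_derivative (\<lambda>\<zeta>. \<zeta> *s h)) (at \<zeta>)"
    using has_derivative_add[OF has_derivative_const] by fastforce
  then have "((\<lambda>\<zeta>. f (u + \<zeta> *s h)) has_derivative (\<lambda>t. D (t *s h))) (at \<zeta>)"
    using has_derivative_compose D(1) by blast
  moreover have "(\<lambda>t. D (t *s h)) = (*) (D h)"
    by (simp add: fun_eq_iff D(2))
  ultimately have "((\<lambda>\<zeta>. f (u + \<zeta> *s h)) has_field_derivative D h) (at \<zeta>)"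
    by (simp add: has_field_derivative_def)
  then show "(\<lambda>\<zeta>. f (u + \<zeta> *s h)) field_differentiable at \<zeta> within A"
    using field_differentiable_at_within field_differentiable_def by blast
qed

section \<open>Weight and norm of the Korenblum space\<close>

definition korenblum_weight :: "real ^ 'n \<Rightarrow> complex ^ 'n \<Rightarrow> real" where
  "korenblum_weight \<gamma> z = (\<Prod>k\<in>UNIV. Im (z $ k) powr (\<gamma> $ k))"

lemma korenblum_weighted_eq: "korenblum_weighted \<gamma> f z = cmod (f z) * korenblum_weight \<gamma> z"
  by (simp add: korenblum_weighted_def korenblum_weight_def)

lemma korenblum_weight_pos: "z \<in> half_plane_poly \<Longrightarrow> korenblum_weight \<gamma> z > 0"
  unfolding korenblum_weight_def half_plane_poly_def
  by (rule prod_pos) (metis (mono_tags, lifting) less_irrefl mem_Collect_eq powr_gt_zero)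

lemma prod_Im_quotient_powr:
  assumes "z \<in> half_plane_poly" "u \<in> half_plane_poly"
  shows "(\<Prod>k\<in>UNIV. (Im (z $ k) / Im (u $ k)) powr (\<gamma> $ k))
    = korenblum_weight \<gamma> z / korenblum_weight \<gamma> u"
proof -
  have "Im (z $ k) > 0" "Im (u $ k) > 0" for k
    using assms by (auto simp: half_plane_poly_def)
  then show ?thesis
    by (simp add: korenblum_weight_def powr_divide less_imp_le prod_dividef)
qed

lemma korenblum_weighted_le_norm:
  assumes "f \<in> korenblum_space \<gamma>" "z \<in> half_plane_poly"
  shows "cmod (f z) * korenblum_weight \<gamma> z \<le> korenblum_norm \<gamma> f"
proof -
  have "korenblum_weighted \<gamma> f z \<le> korenblum_norm \<gamma> f"
    unfolding korenblum_norm_def using assms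
    by (intro cSUP_upper) (auto simp: korenblum_space_def)
  then show ?thesis
    by (simp add: korenblum_weighted_eq)
qed

lemma half_plane_poly_nonempty: "half_plane_poly \<noteq> {}"
proof -
  have "(\<chi> k. \<i>) \<in> half_plane_poly"
    by (simp add: half_plane_poly_def)
  then show ?thesis
    by blast
qed

lemma korenblum_norm_nonneg:
  assumes "f \<in> korenblum_space \<gamma>"
  shows "korenblum_norm \<gamma> f \<ge> 0"
proof -
  obtain z :: "complex ^ 'a" where z: "z \<in> half_plane_poly"
    using half_plane_poly_nonempty by blast
  then have "0 \<le> cmod (f z) * korenblum_weight \<gamma> z"
    using korenblum_weight_pos[of z \<gamma>] by simp
  then show ?thesis
    using korenblum_weighted_le_norm[OF assms z] by linarith
qed

lemma korenblum_norm_le: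
  assumes "\<And>z. z \<in> half_plane_poly \<Longrightarrow> cmod (f z) * korenblum_weight \<gamma> z \<le> C"
  shows "korenblum_norm \<gamma> f \<le> C"
  unfolding korenblum_norm_def
  by (rule cSUP_least[OF half_plane_poly_nonempty]) (simp add: korenblum_weighted_eq assms)

lemma korenblum_spaceI:
  assumes "holomorphic_several_on f half_plane_poly"
    and "\<And>z. z \<in> half_plane_poly \<Longrightarrow> cmod (f z) * korenblum_weight \<gamma> z \<le> C"
  shows "f \<in> korenblum_space \<gamma>"
  using assms by (auto simp: korenblum_space_def korenblum_weighted_eq intro!: bdd_aboveI[of _ C])

section \<open>Pseudo-hyperbolic distance\<close>

lemma pseudo_hyperbolic_dist_commute: "pseudo_hyperbolic_dist u v = pseudo_hyperbolic_dist v u"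
proof -
  have "cmod (u - cnj v) = cmod (v - cnj u)"
    by (metis complex_cnj_cnj complex_cnj_diff complex_mod_cnj norm_minus_commute)
  then show ?thesis
    by (simp add: pseudo_hyperbolic_dist_def norm_divide norm_minus_commute)
qed

lemma pseudo_hyperbolic_max_commute: "pseudo_hyperbolic_max u v = pseudo_hyperbolic_max v u"
  by (simp add: pseudo_hyperbolic_max_def pseudo_hyperbolic_dist_commute)

lemma pseudo_hyperbolic_dist_le_max:
  "pseudo_hyperbolic_dist (u $ k) (v $ k) \<le> pseudo_hyperbolic_max u v"
  by (simp add: pseudo_hyperbolic_max_def)

lemma pseudo_hyperbolic_max_attained:
  obtains j where "pseudo_hyperbolic_max u v = pseudo_hyperbolic_dist (u $ j) (v $ j)"
proof -
  have "pseudo_hyperbolic_max u v \<in> range (\<lambda>k. pseudo_hyperbolic_dist (u $ k) (v $ k))"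
    unfolding pseudo_hyperbolic_max_def by (rule Max_in) auto
  then show ?thesis
    using that by blast
qed

lemma pseudo_hyperbolic_max_nonneg: "pseudo_hyperbolic_max u v \<ge> 0"
  by (rule pseudo_hyperbolic_max_attained[of u v]) (simp add: pseudo_hyperbolic_dist_def)

lemma cmod_diff_le_cmod_diff_cnj:
  assumes "Im u > 0" "Im v > 0"
  shows "cmod (u - v) \<le> cmod (u - cnj v)"
  using assms by (simp add: cmod_def power2_eq_square algebra_simps)

lemma pseudo_hyperbolic_dist_le_1:
  assumes "Im u > 0" "Im v > 0"
  shows "pseudo_hyperbolic_dist u v \<le> 1"
  using cmod_diff_le_cmod_diff_cnj[OF assms]
  by (simp add: pseudo_hyperbolic_dist_def norm_divide divide_le_eq_1)

text \<open>Since \<open>|u - cnj v| \<le> |u - v| + 2 Im u\<close>, points at small pseudo-hyperbolic distance are close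
  in the Euclidean sense on the scale of \<open>Im u\<close>.\<close>

lemma cmod_diff_le_pseudo_hyperbolic:
  assumes "Im u > 0" "Im v > 0" "pseudo_hyperbolic_dist u v \<le> r" "r \<le> 1/10"
  shows "cmod (u - v) \<le> 5/2 * r * Im u"
proof -
  have "Im (u - cnj v) > 0"
    using assms by simp
  then have "u - cnj v \<noteq> 0"
    by (metis less_irrefl zero_complex.sel(2))
  then have "cmod (u - v) \<le> r * cmod (u - cnj v)"
    using assms(3) by (simp add: pseudo_hyperbolic_dist_def norm_divide divide_le_eq)
  moreover have "cmod (u - cnj v) \<le> cmod (u - v) + 2 * Im u"
  proof -
    have "cmod (u - cnj v) \<le> cmod (u - cnj u) + cmod (cnj u - cnj v)"
      by (metis diff_add_cancel add_diff_eq norm_triangle_ineq)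
    moreover have "cmod (u - cnj u) = 2 * Im u"
      using assms(1) by (simp add: complex_diff_cnj norm_mult)
    moreover have "cmod (cnj u - cnj v) = cmod (u - v)"
      by (metis complex_cnj_diff complex_mod_cnj)
    ultimately show ?thesis
      by linarith
  qed
  moreover have "r \<ge> 0"
    using assms(3) by (smt (verit) norm_ge_zero pseudo_hyperbolic_dist_def)
  ultimately have "cmod (u - v) \<le> r * (cmod (u - v) + 2 * Im u)"
    by (smt (verit) mult_left_mono)
  moreover have "r * cmod (u - v) \<le> 1/10 * cmod (u - v)"
    using assms(4) by (intro mult_right_mono) auto
  moreover have "r * Im u \<ge> 0"
    using assms(1) \<open>r \<ge> 0\<close> by simp
  ultimately show ?thesis
    by (simp add: distrib_left)
qed

section \<open>The supremum condition implies boundedness\<close>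

lemma cauchy_increment_bound:
  assumes g: "g holomorphic_on cball 0 (2 * r)" and "r > 0"
    and bound: "\<And>\<zeta>. \<zeta> \<in> cball 0 (2 * r) \<Longrightarrow> cmod (g \<zeta>) \<le> B"
    and "cmod \<zeta> \<le> r"
  shows "cmod (g \<zeta> - g 0) \<le> B / r * cmod \<zeta>"
proof -
  have disc: "cball \<xi> r \<subseteq> cball 0 (2 * r)" if "\<xi> \<in> cball 0 r" for \<xi> :: complex
    using that by (simp add: cball_subset_cball_iff dist_norm)
  have "(g has_field_derivative deriv g \<xi>) (at \<xi> within cball 0 r)" if "\<xi> \<in> cball 0 r" for \<xi>
  proof -
    have "g holomorphic_on ball 0 (2 * r)"
      using g ball_subset_cball holomorphic_on_subset by blast
    moreover have "\<xi> \<in> ball 0 (2 * r)"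
      using that \<open>r > 0\<close> by simp
    ultimately show ?thesis
      using holomorphic_derivI[OF _ open_ball] has_field_derivative_at_within by blast
  qed
  moreover have "cmod (deriv g \<xi>) \<le> B / r" if "\<xi> \<in> cball 0 r" for \<xi>
  proof -
    have "cmod ((deriv ^^ 1) g \<xi>) \<le> fact 1 * B / r ^ 1"
    proof (rule Cauchy_inequality)
      show "g holomorphic_on ball \<xi> r"
        using holomorphic_on_subset[OF g] disc[OF that] ball_subset_cball by blast
      show "continuous_on (cball \<xi> r) g"
        using holomorphic_on_imp_continuous_on holomorphic_on_subset[OF g] disc[OF that] by blast
      show "cmod (g x) \<le> B" if "cmod (\<xi> - x) = r" for x
        using bound disc[OF \<open>\<xi> \<in> cball 0 r\<close>] that
        by (metis dist_norm mem_cball order_refl subsetD)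
    qed fact
    then show ?thesis
      by simp
  qed
  ultimately have "cmod (g \<zeta> - g 0) \<le> B / r * cmod (\<zeta> - 0)"
    using assms by (intro field_differentiable_bound[of "cball 0 r" g "deriv g"]) auto
  then show ?thesis
    by simp
qed

lemma korenblum_weight_half:
  assumes "u \<in> half_plane_poly" "\<And>k. \<gamma> $ k > 0" "\<And>k. Im (w $ k) \<ge> Im (u $ k) / 2"
  shows "korenblum_weight \<gamma> u \<le> (\<Prod>k\<in>UNIV. 2 powr (\<gamma> $ k)) * korenblum_weight \<gamma> w"
proof -
  have u: "Im (u $ k) > 0" for k
    using assms(1) by (simp add: half_plane_poly_def)
  have "Im (u $ k) powr (\<gamma> $ k) \<le> 2 powr (\<gamma> $ k) * Im (w $ k) powr (\<gamma> $ k)" for k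
  proof -
    have "Im (u $ k) powr (\<gamma> $ k) \<le> (2 * Im (w $ k)) powr (\<gamma> $ k)"
      using u[of k] assms(2)[of k] assms(3)[of k] by (intro powr_mono2) auto
    then show ?thesis
      using u[of k] assms(3)[of k] by (simp add: powr_mult)
  qed
  then show ?thesis
    unfolding korenblum_weight_def prod.distrib[symmetric] by (intro prod_mono) auto
qed

text \<open>The local estimate, by Cauchy's inequality on the complex line through \<open>u\<close> and \<open>v\<close>.\<close>

lemma korenblum_difference_bound_near:
  assumes f: "f \<in> korenblum_space \<gamma>" and \<gamma>: "\<And>k. \<gamma> $ k > 0"
    and u: "u \<in> half_plane_poly" and v: "v \<in> half_plane_poly"
    and near: "pseudo_hyperbolic_max u v \<le> 1/10"
  shows "cmod (f u - f v) \<le> 10 * (\<Prod>k\<in>UNIV. 2 powr (\<gamma> $ k)) * korenblum_norm \<gamma> f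
    * pseudo_hyperbolic_max u v / korenblum_weight \<gamma> u"
proof -
  define \<rho> where "\<rho> = pseudo_hyperbolic_max u v"
  define P where "P = (\<Prod>k\<in>UNIV. 2 powr (\<gamma> $ k))"
  define B where "B = P * korenblum_norm \<gamma> f / korenblum_weight \<gamma> u"
  have "\<rho> \<ge> 0"
    unfolding \<rho>_def by (rule pseudo_hyperbolic_max_nonneg)
  have Im_u: "Im (u $ k) > 0" and Im_v: "Im (v $ k) > 0" for k
    using u v by (auto simp: half_plane_poly_def)
  have diff: "cmod (u $ k - v $ k) \<le> 5/2 * \<rho> * Im (u $ k)" for k
    using Im_u Im_v near pseudo_hyperbolic_dist_le_max[of u k v]
    by (intro cmod_diff_le_pseudo_hyperbolic) (auto simp: \<rho>_def)
  \<comment> \<open>For \<open>\<rho> = 0\<close> the direction is \<open>0\<close>, which is consistent because then \<open>u = v\<close>.\<close>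
  define h where "h = complex_of_real (1 / \<rho>) *s (v - u)"
  have h: "cmod (h $ k) \<le> 5/2 * Im (u $ k)" for k
  proof (cases "\<rho> = 0")
    case False
    then have "cmod (h $ k) = cmod (u $ k - v $ k) / \<rho>"
      using \<open>\<rho> \<ge> 0\<close> by (simp add: h_def norm_divide norm_minus_commute flip: diff_divide_distrib)
    then show ?thesis
      using diff[of k] False \<open>\<rho> \<ge> 0\<close> by (simp add: divide_le_eq mult_ac)
  qed (use Im_u[of k] in \<open>simp add: h_def\<close>)
  have end_v: "u + complex_of_real \<rho> *s h = v"
  proof (cases "\<rho> = 0")
    case True
    then have "u $ k = v $ k" for k
      using diff[of k] by simp
    then show ?thesis
      using True by (simp add: vec_eq_iff)
  qed (simp add: h_def vec_eq_iff)
  have Im_line: "Im ((u + \<zeta> *s h) $ k) \<ge> Im (u $ k) / 2" if "\<zeta> \<in> cball 0 (2 * (1/10))" for \<zeta> k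
  proof -
    have "\<bar>Im (\<zeta> * h $ k)\<bar> \<le> cmod \<zeta> * cmod (h $ k)"
      using abs_Im_le_cmod[of "\<zeta> * h $ k"] by (simp add: norm_mult)
    also have "\<dots> \<le> (1/5) * (5/2 * Im (u $ k))"
      using that h[of k] by (intro mult_mono) auto
    finally show ?thesis
      by (simp del: times_complex.sel)
  qed
  have line: "u + \<zeta> *s h \<in> half_plane_poly" if "\<zeta> \<in> cball 0 (2 * (1/10))" for \<zeta>
    unfolding half_plane_poly_def
  proof (rule CollectI, rule allI)
    show "0 < Im ((u + \<zeta> *s h) $ k)" for k
      using Im_line[OF that, of k] Im_u[of k] by linarith
  qed
  have "cmod (f (u + \<zeta> *s h)) \<le> B" if "\<zeta> \<in> cball 0 (2 * (1/10))" for \<zeta>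
  proof -
    let ?w = "u + \<zeta> *s h"
    have "cmod (f ?w) * korenblum_weight \<gamma> u \<le> cmod (f ?w) * (P * korenblum_weight \<gamma> ?w)"
      unfolding P_def using korenblum_weight_half[OF u \<gamma> Im_line[OF that]]
      by (intro mult_left_mono) auto
    also have "\<dots> = P * (cmod (f ?w) * korenblum_weight \<gamma> ?w)"
      by simp
    also have "\<dots> \<le> P * korenblum_norm \<gamma> f"
      using korenblum_weighted_le_norm[OF f line[OF that]]
      by (intro mult_left_mono) (auto simp: P_def intro: prod_nonneg)
    finally show ?thesis
      using korenblum_weight_pos[OF u] by (simp add: B_def le_divide_eq)
  qed
  moreover have "(\<lambda>\<zeta>. f (u + \<zeta> *s h)) holomorphic_on cball 0 (2 * (1/10))"
    using f line by (intro holomorphic_several_on_line) (auto simp: korenblum_space_def)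
  ultimately have "cmod (f (u + complex_of_real \<rho> *s h) - f (u + 0 *s h))
      \<le> B / (1/10) * cmod (complex_of_real \<rho>)"
    using near \<open>\<rho> \<ge> 0\<close>
    by (intro cauchy_increment_bound[where g = "\<lambda>\<zeta>. f (u + \<zeta> *s h)"]) (auto simp: \<rho>_def)
  then show ?thesis
    using \<open>\<rho> \<ge> 0\<close> by (simp add: end_v B_def P_def \<rho>_def[symmetric] norm_minus_commute mult_ac)
qed

lemma korenblum_difference_bound:
  assumes f: "f \<in> korenblum_space \<gamma>" and \<gamma>: "\<And>k. \<gamma> $ k > 0"
    and u: "u \<in> half_plane_poly" and v: "v \<in> half_plane_poly"
  shows "cmod (f u - f v) \<le> 10 * (\<Prod>k\<in>UNIV. 2 powr (\<gamma> $ k)) * korenblum_norm \<gamma> f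
    * ((1 / korenblum_weight \<gamma> u + 1 / korenblum_weight \<gamma> v) * pseudo_hyperbolic_max u v)"
proof -
  define \<rho> where "\<rho> = pseudo_hyperbolic_max u v"
  define P where "P = (\<Prod>k\<in>UNIV. 2 powr (\<gamma> $ k))"
  define N where "N = korenblum_norm \<gamma> f"
  have "P \<ge> 1"
    unfolding P_def using \<gamma> by (intro prod_ge_1) (simp add: ge_one_powr_ge_zero less_imp_le)
  have "N \<ge> 0"
    unfolding N_def by (rule korenblum_norm_nonneg[OF f])
  have "\<rho> \<ge> 0"
    unfolding \<rho>_def by (rule pseudo_hyperbolic_max_nonneg)
  have Wu: "korenblum_weight \<gamma> u > 0" and Wv: "korenblum_weight \<gamma> v > 0"
    using u v by (simp_all add: korenblum_weight_pos)
  show ?thesis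
  proof (cases "\<rho> \<le> 1/10")
    case True
    have "cmod (f u - f v) \<le> 10 * P * N * \<rho> * (1 / korenblum_weight \<gamma> u)"
      using korenblum_difference_bound_near[OF f \<gamma> u v] True by (simp add: P_def N_def \<rho>_def)
    also have "\<dots> \<le> 10 * P * N * \<rho> * (1 / korenblum_weight \<gamma> u + 1 / korenblum_weight \<gamma> v)"
      using \<open>P \<ge> 1\<close> \<open>N \<ge> 0\<close> \<open>\<rho> \<ge> 0\<close> Wv by (intro mult_left_mono) auto
    finally show ?thesis
      by (simp add: P_def N_def \<rho>_def mult_ac)
  next
    case False
    let ?s = "1 / korenblum_weight \<gamma> u + 1 / korenblum_weight \<gamma> v"
    have "cmod (f u) \<le> N / korenblum_weight \<gamma> u" "cmod (f v) \<le> N / korenblum_weight \<gamma> v"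
      using korenblum_weighted_le_norm[OF f u] korenblum_weighted_le_norm[OF f v] Wu Wv
      by (simp_all add: N_def le_divide_eq)
    then have "cmod (f u - f v) \<le> 1 * (N * ?s)"
      using norm_triangle_ineq4[of "f u" "f v"] by (simp add: distrib_left)
    also have "\<dots> \<le> (10 * P * \<rho>) * (N * ?s)"
    proof (rule mult_right_mono)
      show "1 \<le> 10 * P * \<rho>"
        using mult_mono[of 1 P 1 "10 * \<rho>"] False \<open>P \<ge> 1\<close> by simp
      show "0 \<le> N * ?s"
        using \<open>N \<ge> 0\<close> Wu Wv by simp
    qed
    finally show ?thesis
      by (simp add: P_def N_def \<rho>_def mult_ac)
  qed
qed

text \<open>Linearity of the difference of two composition operators is immediate, so boundedness follows
  from a pointwise estimate of its weighted values.\<close>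

lemma korenblum_bounded_composition_difference:
  assumes \<phi>: "holomorphic_self_map \<phi>" and \<psi>: "holomorphic_self_map \<psi>"
    and bound: "\<And>f z. f \<in> korenblum_space \<gamma> \<Longrightarrow> z \<in> half_plane_poly \<Longrightarrow>
      cmod (f (\<phi> z) - f (\<psi> z)) * korenblum_weight \<gamma> z \<le> C * korenblum_norm \<gamma> f"
  shows "korenblum_bounded_operator \<gamma>
    (\<lambda>f z. composition_operator \<phi> f z - composition_operator \<psi> f z)"
proof -
  let ?T = "\<lambda>f z. composition_operator \<phi> f z - composition_operator \<psi> f z"
  have maps: "?T f \<in> korenblum_space \<gamma>" if f: "f \<in> korenblum_space \<gamma>" for f
  proof (rule korenblum_spaceI)
    have holf: "holomorphic_several_on f half_plane_poly"
      using f by (simp add: korenblum_space_def)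
    show "holomorphic_several_on (?T f) half_plane_poly"
      unfolding composition_operator_def using \<phi> \<psi>
      by (intro holomorphic_several_on_diff holomorphic_several_on_compose[OF holf])
        (auto simp: holomorphic_self_map_def)
    show "cmod (?T f z) * korenblum_weight \<gamma> z \<le> C * korenblum_norm \<gamma> f"
      if "z \<in> half_plane_poly" for z
      using bound[OF f that] by (simp add: composition_operator_def)
  qed
  have bounded: "korenblum_norm \<gamma> (?T f) \<le> C * korenblum_norm \<gamma> f" if "f \<in> korenblum_space \<gamma>" for f
    using bound[OF that] by (intro korenblum_norm_le) (simp add: composition_operator_def)
  show ?thesis
    unfolding korenblum_bounded_operator_def
  proof (intro conjI ballI allI exI[of _ C] funcsetI)
    show "?T (\<lambda>w. f w + g w) z = ?T f z + ?T g z" "?T (\<lambda>w. c * f w) z = c * ?T f z" for f g c z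
      by (simp_all add: composition_operator_def algebra_simps)
  qed (fact maps, fact bounded)
qed

section \<open>Boundedness implies the supremum condition\<close>

definition korenblum_kernel :: "real ^ 'n \<Rightarrow> complex ^ 'n \<Rightarrow> complex ^ 'n \<Rightarrow> complex" where
  "korenblum_kernel \<gamma> u w =
     (\<Prod>k\<in>UNIV. (- \<i> * (w $ k - cnj (u $ k))) powr complex_of_real (- (\<gamma> $ k)))"

text \<open>On the half-plane the base \<open>-i (w - cnj u)\<close> has positive real part \<open>Im w + Im u\<close> and thus
  avoids the branch cut of the complex power.\<close>

lemma holomorphic_korenblum_kernel:
  assumes "u \<in> half_plane_poly"
  shows "holomorphic_several_on (korenblum_kernel \<gamma> u) half_plane_poly"
  unfolding korenblum_kernel_def
proof (rule holomorphic_several_on_prod)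
  fix k
  let ?g = "\<lambda>s. (- \<i> * (s - cnj (u $ k))) powr complex_of_real (- (\<gamma> $ k))"
  have "- \<i> * (s - cnj (u $ k)) \<notin> \<real>\<^sub>\<le>\<^sub>0" if "Im s > 0" for s
  proof -
    have "Re (- \<i> * (s - cnj (u $ k))) > 0"
      using that assms by (simp add: half_plane_poly_def pos_add_strict)
    then show ?thesis
      by (auto simp: complex_nonpos_Reals_iff)
  qed
  moreover have "(\<lambda>s. - \<i> * (s - cnj (u $ k))) holomorphic_on {s. Im s > 0}"
    by (intro holomorphic_on_mult holomorphic_on_diff holomorphic_on_const holomorphic_on_ident)
  ultimately have "?g holomorphic_on {s. Im s > 0}"
    by (intro holomorphic_on_powr holomorphic_on_const) blast+
  then have "?g field_differentiable at s" if "Im s > 0" for s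
    by (rule holomorphic_on_imp_differentiable_at[OF _ open_halfspace_Im_gt]) (simp add: that)
  then show "holomorphic_several_on
      (\<lambda>w. (- \<i> * (w $ k - cnj (u $ k))) powr complex_of_real (- (\<gamma> $ k))) half_plane_poly"
    by (intro holomorphic_several_on_coordinate[where g = ?g]) (simp add: half_plane_poly_def)
qed simp

lemma cmod_korenblum_kernel:
  "cmod (korenblum_kernel \<gamma> u w) = (\<Prod>k\<in>UNIV. cmod (w $ k - cnj (u $ k)) powr (- (\<gamma> $ k)))"
  unfolding korenblum_kernel_def prod_norm[symmetric]
  by (simp add: norm_powr_real_powr' norm_mult)

text \<open>The kernel is weighted by at most \<open>1\<close> because \<open>|w - cnj u| \<ge> Im w + Im u \<ge> Im w\<close>.\<close>

lemma korenblum_kernel_weighted_le_1: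
  assumes "u \<in> half_plane_poly" "w \<in> half_plane_poly" "\<And>k. \<gamma> $ k > 0"
  shows "cmod (korenblum_kernel \<gamma> u w) * korenblum_weight \<gamma> w \<le> 1"
proof -
  have "cmod (w $ k - cnj (u $ k)) powr (- (\<gamma> $ k)) * Im (w $ k) powr (\<gamma> $ k) \<le> 1" for k
  proof -
    have Im_pos: "Im (w $ k) > 0" "Im (u $ k) > 0"
      using assms by (auto simp: half_plane_poly_def)
    have "Im (w $ k) \<le> cmod (w $ k - cnj (u $ k))"
      using abs_Im_le_cmod[of "w $ k - cnj (u $ k)"] Im_pos by simp
    then have "Im (w $ k) powr (\<gamma> $ k) \<le> cmod (w $ k - cnj (u $ k)) powr (\<gamma> $ k)"
      using Im_pos assms(3)[of k] by (intro powr_mono2) auto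
    then show ?thesis
      by (simp add: powr_minus_divide divide_le_eq_1)
  qed
  then show ?thesis
    unfolding cmod_korenblum_kernel korenblum_weight_def prod.distrib[symmetric]
    by (intro prod_le_1) auto
qed

lemma korenblum_kernel_diagonal:
  assumes "u \<in> half_plane_poly"
  shows "cmod (korenblum_kernel \<gamma> u u) = 1 / ((\<Prod>k\<in>UNIV. 2 powr (\<gamma> $ k)) * korenblum_weight \<gamma> u)"
proof -
  have "cmod (u $ k - cnj (u $ k)) powr (- (\<gamma> $ k)) = 1 / (2 powr (\<gamma> $ k) * Im (u $ k) powr (\<gamma> $ k))"
    for k
  proof -
    have "Im (u $ k) > 0"
      using assms by (simp add: half_plane_poly_def)
    then show ?thesis
      by (simp add: complex_diff_cnj norm_mult powr_minus_divide powr_mult)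
  qed
  then show ?thesis
    by (simp add: cmod_korenblum_kernel korenblum_weight_def prod_dividef prod.distrib)
qed

text \<open>The kernel at \<open>u\<close>, and its product with the Blaschke factor that vanishes at \<open>u\<close> in the
  coordinate \<open>j\<close> of maximal distance, serve as test functions. The bound is phrased for two points
  and a weight \<open>W\<close> instead of self-maps, so that it applies to both orders of the two self-maps.\<close>

lemma korenblum_test_functions:
  assumes u: "u \<in> half_plane_poly" and v: "v \<in> half_plane_poly" and \<gamma>: "\<And>k. \<gamma> $ k > 0"
    and "W \<ge> 0"
    and bound: "\<And>f. f \<in> korenblum_space \<gamma> \<Longrightarrow> korenblum_norm \<gamma> f \<le> 1 \<Longrightarrow> cmod (f u - f v) * W \<le> C"
  shows "W / korenblum_weight \<gamma> u * pseudo_hyperbolic_max u v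
    \<le> 2 * C * (\<Prod>k\<in>UNIV. 2 powr (\<gamma> $ k))"
proof -
  obtain j where j: "pseudo_hyperbolic_max u v = pseudo_hyperbolic_dist (u $ j) (v $ j)"
    by (rule pseudo_hyperbolic_max_attained)
  define d where "d = pseudo_hyperbolic_dist (u $ j) (v $ j)"
  define P where "P = (\<Prod>k\<in>UNIV. 2 powr (\<gamma> $ k))"
  let ?K = "korenblum_kernel \<gamma> u"
  let ?B = "\<lambda>s. (s - u $ j) / (s - cnj (u $ j))"
  let ?F = "\<lambda>w. ?K w * ?B (w $ j)"
  have Im_u: "Im (u $ j) > 0" and Im_v: "Im (v $ j) > 0"
    using u v by (auto simp: half_plane_poly_def)
  have K: "cmod (?K w) * korenblum_weight \<gamma> w \<le> 1" if "w \<in> half_plane_poly" for w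
    by (rule korenblum_kernel_weighted_le_1[OF u that \<gamma>])
  have "cmod (?K u - ?K v) * W \<le> C"
    using K by (intro bound korenblum_spaceI[OF holomorphic_korenblum_kernel[OF u]] korenblum_norm_le)
  have F: "cmod (?F w) * korenblum_weight \<gamma> w \<le> 1" if w: "w \<in> half_plane_poly" for w
  proof -
    have "cmod (?B (w $ j)) \<le> 1"
      using pseudo_hyperbolic_dist_le_1[of "w $ j" "u $ j"] Im_u w
      by (simp add: pseudo_hyperbolic_dist_def half_plane_poly_def)
    then have "(cmod (?K w) * korenblum_weight \<gamma> w) * cmod (?B (w $ j)) \<le> 1 * 1"
      using K[OF w] by (intro mult_mono) auto
    then show ?thesis
      by (simp add: norm_mult norm_divide mult_ac)
  qed
  have "?B field_differentiable at s" if "Im s > 0" for s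
  proof -
    have "s - cnj (u $ j) \<noteq> 0"
      using that Im_u by (auto simp: complex_eq_iff)
    then show ?thesis
      by (intro derivative_intros) auto
  qed
  then have "holomorphic_several_on ?F half_plane_poly"
    by (intro holomorphic_several_on_mult holomorphic_korenblum_kernel[OF u]
        holomorphic_several_on_coordinate[where g = ?B]) (simp add: half_plane_poly_def)
  then have "cmod (?F u - ?F v) * W \<le> C"
    using F by (intro bound korenblum_spaceI[of ?F] korenblum_norm_le)
  moreover have "cmod (?F u - ?F v) = cmod (?K v) * d"
    unfolding d_def by (subst pseudo_hyperbolic_dist_commute)
      (simp add: norm_mult norm_divide pseudo_hyperbolic_dist_def)
  ultimately have Kv: "cmod (?K v) * d * W \<le> C"
    by simp
  have "0 \<le> d" "d \<le> 1"
    using pseudo_hyperbolic_dist_le_1[OF Im_u Im_v] by (simp_all add: d_def pseudo_hyperbolic_dist_def)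
  have "cmod (?K u) * d * W \<le> (cmod (?K u - ?K v) + cmod (?K v)) * d * W"
    using \<open>0 \<le> d\<close> \<open>W \<ge> 0\<close> norm_triangle_ineq[of "?K u - ?K v" "?K v"]
    by (intro mult_right_mono) auto
  also have "\<dots> = (cmod (?K u - ?K v) * W) * d + cmod (?K v) * d * W"
    by (simp add: algebra_simps)
  also have "\<dots> \<le> (cmod (?K u - ?K v) * W) * 1 + cmod (?K v) * d * W"
    using \<open>d \<le> 1\<close> \<open>W \<ge> 0\<close> by (intro add_right_mono mult_left_mono) auto
  also have "\<dots> \<le> 2 * C"
    using Kv \<open>cmod (?K u - ?K v) * W \<le> C\<close> by simp
  finally have "1 / (P * korenblum_weight \<gamma> u) * d * W \<le> 2 * C"
    by (simp add: korenblum_kernel_diagonal[OF u] P_def)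
  moreover have "P > 0"
    by (simp add: P_def prod_pos)
  ultimately show ?thesis
    using korenblum_weight_pos[OF u, of \<gamma>] by (simp add: j d_def P_def field_simps)
qed

section \<open>Boundedness of differences of composition operators\<close>

theorem theorem4p1:
  fixes \<phi> \<psi> :: "complex ^ 'n \<Rightarrow> complex ^ 'n" and \<gamma> :: "real ^ 'n"
  assumes "holomorphic_self_map \<phi>" and "holomorphic_self_map \<psi>"
    and "\<And>k. \<gamma> $ k > 0"
  shows "bdd_above ((\<lambda>z.
             ((\<Prod>k\<in>UNIV. (Im (z $ k) / Im (\<phi> z $ k)) powr (\<gamma> $ k)) +
              (\<Prod>k\<in>UNIV. (Im (z $ k) / Im (\<psi> z $ k)) powr (\<gamma> $ k)))
             * pseudo_hyperbolic_max (\<phi> z) (\<psi> z)) ` half_plane_poly)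
     \<longleftrightarrow>
         korenblum_bounded_operator \<gamma>
           (\<lambda>f z. composition_operator \<phi> f z - composition_operator \<psi> f z)"
    (is "bdd_above (?q ` _) \<longleftrightarrow> korenblum_bounded_operator \<gamma> ?T")
proof -
  define P where "P = (\<Prod>k\<in>UNIV. 2 powr (\<gamma> $ k))"
  have \<phi>: "\<phi> z \<in> half_plane_poly" and \<psi>: "\<psi> z \<in> half_plane_poly" if "z \<in> half_plane_poly" for z
    using assms(1,2) that by (auto simp: holomorphic_self_map_def)
  have q: "?q z = (korenblum_weight \<gamma> z / korenblum_weight \<gamma> (\<phi> z)
      + korenblum_weight \<gamma> z / korenblum_weight \<gamma> (\<psi> z)) * pseudo_hyperbolic_max (\<phi> z) (\<psi> z)"
    if "z \<in> half_plane_poly" for z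
    using that \<phi>[OF that] \<psi>[OF that] by (simp add: prod_Im_quotient_powr)
  show ?thesis
  proof
    assume "bdd_above (?q ` half_plane_poly)"
    then obtain M where M: "?q z \<le> M" if "z \<in> half_plane_poly" for z
      by (auto simp: bdd_above_def)
    have "cmod (f (\<phi> z) - f (\<psi> z)) * korenblum_weight \<gamma> z \<le> 10 * P * M * korenblum_norm \<gamma> f"
      if f: "f \<in> korenblum_space \<gamma>" and z: "z \<in> half_plane_poly" for f z
    proof -
      have "cmod (f (\<phi> z) - f (\<psi> z)) * korenblum_weight \<gamma> z \<le> 10 * P * korenblum_norm \<gamma> f
          * ((1 / korenblum_weight \<gamma> (\<phi> z) + 1 / korenblum_weight \<gamma> (\<psi> z))
            * pseudo_hyperbolic_max (\<phi> z) (\<psi> z)) * korenblum_weight \<gamma> z"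
        unfolding P_def using korenblum_weight_pos[OF z]
        by (intro mult_right_mono korenblum_difference_bound[OF f assms(3) \<phi>[OF z] \<psi>[OF z]])
          (simp add: less_imp_le)
      also have "\<dots> = 10 * P * korenblum_norm \<gamma> f * ?q z"
        unfolding q[OF z] by (simp add: algebra_simps)
      also have "\<dots> \<le> 10 * P * korenblum_norm \<gamma> f * M"
        using korenblum_norm_nonneg[OF f] M[OF z]
        by (intro mult_left_mono) (auto simp: P_def intro!: mult_nonneg_nonneg prod_nonneg)
      finally show ?thesis
        by (simp add: mult_ac)
    qed
    then show "korenblum_bounded_operator \<gamma> ?T"
      by (rule korenblum_bounded_composition_difference[OF assms(1,2)])
  next
    assume "korenblum_bounded_operator \<gamma> ?T"
    note T = this[unfolded korenblum_bounded_operator_def]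
    obtain C where C: "\<forall>f\<in>korenblum_space \<gamma>. korenblum_norm \<gamma> (?T f) \<le> C * korenblum_norm \<gamma> f"
      using T by (elim conjE exE)
    have bound: "cmod (f (\<phi> z) - f (\<psi> z)) * korenblum_weight \<gamma> z \<le> \<bar>C\<bar>"
      if f: "f \<in> korenblum_space \<gamma>" "korenblum_norm \<gamma> f \<le> 1" and z: "z \<in> half_plane_poly" for f z
    proof -
      have "?T f \<in> korenblum_space \<gamma>"
        by (rule funcset_mem[OF conjunct1[OF T] f(1)])
      from korenblum_weighted_le_norm[OF this z]
      have "cmod (f (\<phi> z) - f (\<psi> z)) * korenblum_weight \<gamma> z \<le> C * korenblum_norm \<gamma> f"
        using bspec[OF C f(1)] by (simp add: composition_operator_def)
      also have "\<dots> \<le> \<bar>C\<bar> * 1"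
        using korenblum_norm_nonneg[OF f(1)] f(2) by (intro mult_mono) auto
      finally show ?thesis
        by simp
    qed
    have "?q z \<le> 4 * \<bar>C\<bar> * P" if z: "z \<in> half_plane_poly" for z
    proof -
      have W: "korenblum_weight \<gamma> z \<ge> 0"
        using korenblum_weight_pos[OF z, of \<gamma>] by simp
      have "korenblum_weight \<gamma> z / korenblum_weight \<gamma> (\<phi> z) * pseudo_hyperbolic_max (\<phi> z) (\<psi> z)
          \<le> 2 * \<bar>C\<bar> * P"
        unfolding P_def using bound z
        by (intro korenblum_test_functions[OF \<phi>[OF z] \<psi>[OF z] assms(3) W]) auto
      moreover have "korenblum_weight \<gamma> z / korenblum_weight \<gamma> (\<psi> z)
            * pseudo_hyperbolic_max (\<psi> z) (\<phi> z) \<le> 2 * \<bar>C\<bar> * P"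
        unfolding P_def using bound z
        by (intro korenblum_test_functions[OF \<psi>[OF z] \<phi>[OF z] assms(3) W])
          (auto simp: norm_minus_commute)
      ultimately show ?thesis
        unfolding q[OF z] by (simp add: distrib_right pseudo_hyperbolic_max_commute[of "\<psi> z"])
    qed
    then show "bdd_above (?q ` half_plane_poly)"
      by (intro bdd_aboveI) auto
  qed
qed

end
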